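(* For $u,v,w\in S_n$ the following are equivalent: (1) $w$ lies in the tilted Bruhat interval $[u,v]$; (2) for all $\mathbf{a}\in[n]^n$ with $u\le_{\mathbf{a}}v$, we have $u\le_{\mathbf{a}}w\le_{\mathbf{a}}v$; (3) there exists $\mathbf{a}\in[n]^n$ with $u\le_{\mathbf{a}}w\le_{\mathbf{a}}v$; (4) for all $\mathbf{a}\in[n]^n$ with $u\lesssim_{\mathbf{a}}v$, we have $u\lesssim_{\mathbf{a}}w\lesssim_{\mathbf{a}}v$; (5) there exists $\mathbf{a}\in[n]^n$ with $u\lesssim_{\mathbf{a}}w\lesssim_{\mathbf{a}}v$.
   Context: Permutations are in one-line notation $w=w_1\cdots w_n$, $w[k]:=\{w_1,\dots,w_k\}$; $wt_{ij}$ swaps the entries of $w$ in positions $i<j$; $\ell(w)$ is the number of inversions. Quantum Bruhat graph $\Gamma_n$: directed graph on $S_n$ with an edge $w\to wt_{ij}$ ($i<j$) whenever $\ell(wt_{ij})=\ell(w)+1$ or $\ell(wt_{ij})=\ell(w)+1-2(j-i)$. Let $\ell(x,y)$ be the length of a shortest directed path from $x$ to $y$ in $\Gamma_n$. The tilted Bruhat interval is $[u,v]:=\{w\in S_n:\ell(u,w)+\ell(w,v)=\ell(u,v)\}$. Cyclic interval $[a,b)_c$: $\{a,\dots,b-1\}$ if $a\le b$, $\{a,\dots,n\}\cup\{1,\dots,b-1\}$ if $a>b$. For $r\in[n]$, $<_r$ is the order $r<_r r+1<_r\cdots<_r n<_r 1<_r\cdots<_r r-1$ on $[n]$; for $k$-subsets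 $A=\{a_1<_r\cdots<_r a_k\}$, $B=\{b_1<_r\cdots<_r b_k\}$, $A\le_r B$ means $a_i\le_r b_i$ for all $i$. For $\mathbf{a}=(a_1,\dots,a_n)\in[n]^n$: $u\le_{\mathbf{a}}v$ iff $u[k]\le_{a_k}v[k]$ for all $k\in[n]$; $u\sim_{\mathbf{a}}v$ iff $|u[k]\cap[a_k,a_{k+1})_c|=|v[k]\cap[a_k,a_{k+1})_c|$ for all $k\in[n-1]$; $u\lesssim_{\mathbf{a}}v$ iff $u\le_{\mathbf{a}}v$ and $u\sim_{\mathbf{a}}v$. *)

theory Defs
  imports "HOL-Combinatorics.Permutations" "HOL-Library.FuncSet"
begin

text \<open>
  The symmetric group \<open>S\<^sub>n\<close> consists of the functions \<open>w\<close> with \<open>w permutes {1..n}\<close>, with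
  \<open>w i\<close> the \<open>i\<close>-th letter of the one-line notation. Since \<open>transpose i j\<close> is composed on the right,
  \<open>w \<circ> transpose i j\<close> swaps the entries in \<^emph>\<open>positions\<close> \<open>i\<close> and \<open>j\<close>.
\<close>

definition perm_length :: "nat \<Rightarrow> (nat \<Rightarrow> nat) \<Rightarrow> nat" where
  "perm_length n w = card {(i, j). 1 \<le> i \<and> i < j \<and> j \<le> n \<and> w i > w j}"

text \<open>
  The edge condition is stated in \<^typ>\<open>int\<close>, as \<open>\<ell>(w) + 1 - 2(j - i)\<close> may be negative.
\<close>

definition qbg :: "nat \<Rightarrow> ((nat \<Rightarrow> nat) \<times> (nat \<Rightarrow> nat)) set" where
  "qbg n = {(w, w \<circ> transpose i j) | w i j.
     w permutes {1..n} \<and> 1 \<le> i \<and> i < j \<and> j \<le> n \<and>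
     (int (perm_length n (w \<circ> transpose i j)) = int (perm_length n w) + 1 \<or>
      int (perm_length n (w \<circ> transpose i j)) =
        int (perm_length n w) + 1 - 2 * (int j - int i))}"

text \<open>
  The minimum is over a nonempty set for \<open>x\<close>, \<open>y\<close> in \<open>S\<^sub>n\<close>: for \<open>j = i + 1\<close> one of
  the two edge conditions always holds, so the graph is strongly connected.
\<close>

definition qbg_dist :: "nat \<Rightarrow> (nat \<Rightarrow> nat) \<Rightarrow> (nat \<Rightarrow> nat) \<Rightarrow> nat" where
  "qbg_dist n x y = (LEAST k. (x, y) \<in> qbg n ^^ k)"

definition tilted_interval :: "nat \<Rightarrow> (nat \<Rightarrow> nat) \<Rightarrow> (nat \<Rightarrow> nat) \<Rightarrow> (nat \<Rightarrow> nat) set" where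
  "tilted_interval n u v =
     {w. w permutes {1..n} \<and> qbg_dist n u w + qbg_dist n w v = qbg_dist n u v}"

definition cyclic_interval :: "nat \<Rightarrow> nat \<Rightarrow> nat \<Rightarrow> nat set" where
  "cyclic_interval n a b = (if a \<le> b then {a..<b} else {a..n} \<union> {1..<b})"

text \<open>
  The order \<open>r < r + 1 < \<dots> < n < 1 < \<dots> < r - 1\<close>: every element of \<open>{r..n}\<close> precedes every
  element of \<open>{1..<r}\<close>, and within each block the order is the usual one.
\<close>

definition cyc_less :: "nat \<Rightarrow> nat \<Rightarrow> nat \<Rightarrow> bool" where
  "cyc_less r x y \<longleftrightarrow> (r \<le> x \<and> y < r) \<or> ((r \<le> x \<longleftrightarrow> r \<le> y) \<and> x < y)"

definition cyc_le :: "nat \<Rightarrow> nat \<Rightarrow> nat \<Rightarrow> bool" where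
  "cyc_le r x y \<longleftrightarrow> cyc_less r x y \<or> x = y"

text \<open>
  The lists are the (unique) increasing enumerations \<open>a\<^sub>1, \<dots>, a\<^sub>k\<close> and \<open>b\<^sub>1, \<dots>, b\<^sub>k\<close>
  of \<open>A\<close> and \<open>B\<close>.
\<close>

definition set_le :: "nat \<Rightarrow> nat set \<Rightarrow> nat set \<Rightarrow> bool" where
  "set_le r A B \<longleftrightarrow> (\<exists>as bs. set as = A \<and> sorted_wrt (cyc_less r) as \<and>
     set bs = B \<and> sorted_wrt (cyc_less r) bs \<and> list_all2 (cyc_le r) as bs)"

definition tilted_le :: "nat \<Rightarrow> (nat \<Rightarrow> nat) \<Rightarrow> (nat \<Rightarrow> nat) \<Rightarrow> (nat \<Rightarrow> nat) \<Rightarrow> bool" where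
  "tilted_le n a u v \<longleftrightarrow> (\<forall>k\<in>{1..n}. set_le (a k) (u ` {1..k}) (v ` {1..k}))"

definition tilted_sim :: "nat \<Rightarrow> (nat \<Rightarrow> nat) \<Rightarrow> (nat \<Rightarrow> nat) \<Rightarrow> (nat \<Rightarrow> nat) \<Rightarrow> bool" where
  "tilted_sim n a u v \<longleftrightarrow> (\<forall>k\<in>{1..<n}.
     card (u ` {1..k} \<inter> cyclic_interval n (a k) (a (k + 1))) =
     card (v ` {1..k} \<inter> cyclic_interval n (a k) (a (k + 1))))"

definition tilted_lesssim :: "nat \<Rightarrow> (nat \<Rightarrow> nat) \<Rightarrow> (nat \<Rightarrow> nat) \<Rightarrow> (nat \<Rightarrow> nat) \<Rightarrow> bool" where
  "tilted_lesssim n a u v \<longleftrightarrow> tilted_le n a u v \<and> tilted_sim n a u v"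

end

theory Submission
  imports Defs
begin

text \<open>
  For \<open>u, v\<close> and each \<open>k\<close> consider the function sending \<open>c\<close> to
  \<open>|v[k] \<inter> [1,c]| - |u[k] \<inter> [1,c]|\<close> (the excess), viewed on the cycle obtained by identifying
  \<open>c = 0\<close> with \<open>c = n\<close>. Then \<open>u[k] \<le>\<^sub>r v[k]\<close> says precisely that \<open>r - 1\<close> maximizes it. With \<open>depth\<close>
  denoting this maximum, the distance from \<open>u\<close> to \<open>v\<close> in the quantum Bruhat graph is
  \<open>\<ell>(v) - \<ell>(u) + 2 \<Sum>\<^sub>k depth\<^sub>k\<close>. Since excesses add, depths are subadditive, so \<open>w\<close> lies in \<open>[u,v]\<close>
  iff the depths add for every \<open>k\<close>, which happens iff some (equivalently, every) maximizer for
  \<open>(u,v)\<close> is a maximizer for both \<open>(u,w)\<close> and \<open>(w,v)\<close>. Finally, the excesses for \<open>k - 1\<close> and \<open>k\<close>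
  always share a maximizer, which yields some \<open>a\<close> with \<open>u \<lesssim>\<^sub>a v\<close>.
\<close>

section \<open>Prefix counts, excess and depth\<close>

definition prefix_count :: "(nat \<Rightarrow> nat) \<Rightarrow> nat \<Rightarrow> nat \<Rightarrow> int" where
  "prefix_count w k c = (\<Sum>m=1..k. of_bool (w m \<le> c))"

definition excess :: "(nat \<Rightarrow> nat) \<Rightarrow> (nat \<Rightarrow> nat) \<Rightarrow> nat \<Rightarrow> nat \<Rightarrow> int" where
  "excess u v k c = prefix_count v k c - prefix_count u k c"

definition depth :: "nat \<Rightarrow> (nat \<Rightarrow> nat) \<Rightarrow> (nat \<Rightarrow> nat) \<Rightarrow> nat \<Rightarrow> int" where
  "depth n u v k = Max (excess u v k ` {..n})"

definition potential :: "nat \<Rightarrow> (nat \<Rightarrow> nat) \<Rightarrow> (nat \<Rightarrow> nat) \<Rightarrow> int" where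
  "potential n u v =
     int (perm_length n v) - int (perm_length n u) + 2 * (\<Sum>k=1..n. depth n u v k)"

lemma prefix_count_card: "prefix_count w k c = int (card {m \<in> {1..k}. w m \<le> c})"
  by (simp add: prefix_count_def Int_def)

lemma prefix_count_image:
  assumes "inj w"
  shows "prefix_count w k c = int (card {x \<in> w ` {1..k}. x \<le> c})"
proof -
  have "{x \<in> w ` {1..k}. x \<le> c} = w ` {m \<in> {1..k}. w m \<le> c}"
    by auto
  then show ?thesis
    using assms by (simp add: prefix_count_card card_image inj_on_def)
qed

lemma permutes_le:
  assumes "w permutes {1..n}" "m \<in> {1..n}"
  shows "1 \<le> w m" "w m \<le> n"
  using permutes_in_image[OF assms(1), of m] assms(2) by auto

lemma prefix_count_top:
  assumes "w permutes {1..n}" "k \<le> n" "n \<le> c"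
  shows "prefix_count w k c = int k"
proof -
  have "{m \<in> {1..k}. w m \<le> c} = {1..k}"
    using permutes_le(2)[OF assms(1)] assms(2,3) by fastforce
  then show ?thesis by (simp add: prefix_count_card)
qed

lemma prefix_count_0:
  assumes "w permutes {1..n}" "k \<le> n"
  shows "prefix_count w k 0 = 0"
proof -
  have "{m \<in> {1..k}. w m \<le> 0} = {}"
    using permutes_le(1)[OF assms(1)] assms(2) by fastforce
  then show ?thesis by (simp only: prefix_count_card) simp
qed

lemma excess_0:
  assumes "u permutes {1..n}" "v permutes {1..n}" "k \<le> n"
  shows "excess u v k 0 = 0"
  using assms by (simp add: excess_def prefix_count_0)

lemma excess_top:
  assumes "u permutes {1..n}" "v permutes {1..n}" "k \<le> n" "n \<le> c"
  shows "excess u v k c = 0"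
  using assms by (simp add: excess_def prefix_count_top)

lemma excess_add: "excess u w k c + excess w v k c = excess u v k c"
  by (simp add: excess_def)

text \<open>From \<open>n\<close> on the excess is constantly 0, so the maximum over
  \<open>{..n}\<close> bounds it at every natural \<open>c\<close>. This is why
  \<open>argmax\<close> can range over the whole type.\<close>

lemma depth_ge:
  assumes "u permutes {1..n}" "v permutes {1..n}" "k \<le> n"
  shows "excess u v k c \<le> depth n u v k"
proof (cases "c \<le> n")
  case True
  then show ?thesis by (simp add: depth_def)
next
  case False
  then have "excess u v k c = excess u v k n"
    using assms by (simp add: excess_top)
  then show ?thesis by (simp add: depth_def)
qed

lemma depth_leI:
  assumes "\<And>c. excess u v k c \<le> b"
  shows "depth n u v k \<le> b"
  unfolding depth_def using assms by (subst Max_le_iff) auto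

lemma depth_attained:
  assumes "u permutes {1..n}" "v permutes {1..n}" "k \<in> {1..n}"
  obtains r where "r \<in> {1..n}" "excess u v k (r - 1) = depth n u v k"
proof -
  have "depth n u v k \<in> excess u v k ` {..n}"
    unfolding depth_def by (rule Max_in) auto
  then obtain c where c: "c \<le> n" "depth n u v k = excess u v k c" by auto
  show thesis
  proof (cases "c = n")
    case True
    \<comment> \<open>The excess vanishes at both \<open>n\<close> and 0, so a maximum at
      \<open>n\<close> is also attained at 0, that is, for \<open>r = 1\<close>; this keeps
      \<open>r\<close> in \<open>{1..n}\<close>.\<close>
    then have "excess u v k (1 - 1) = depth n u v k"
      using c assms by (simp add: excess_0 excess_top)
    then show thesis using assms(3) by (intro that[of 1]) auto
  next
    case False
    then show thesis using c by (intro that[of "Suc c"]) auto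
  qed
qed

lemma depth_triangle:
  assumes "u permutes {1..n}" "v permutes {1..n}" "w permutes {1..n}" "k \<le> n"
  shows "depth n u v k \<le> depth n u w k + depth n w v k"
proof (rule depth_leI)
  fix c
  show "excess u v k c \<le> depth n u w k + depth n w v k"
    using depth_ge[OF assms(1,3,4), of c] depth_ge[OF assms(3,2,4), of c]
      excess_add[of u w k c v] by linarith
qed

section \<open>Maximizers of the excess\<close>

definition argmax :: "('a \<Rightarrow> int) \<Rightarrow> 'a \<Rightarrow> bool" where
  "argmax f p \<longleftrightarrow> (\<forall>c. f c \<le> f p)"

lemma argmax_depth:
  assumes "u permutes {1..n}" "v permutes {1..n}" "k \<in> {1..n}"
  shows "argmax (excess u v k) p \<longleftrightarrow> excess u v k p = depth n u v k"
proof
  obtain r where "excess u v k (r - 1) = depth n u v k"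
    using depth_attained[OF assms] by blast
  moreover assume "argmax (excess u v k) p"
  ultimately show "excess u v k p = depth n u v k"
    using depth_ge[OF assms(1,2), of k p] assms(3)
    by (metis argmax_def atLeastAtMost_iff order_antisym)
next
  assume "excess u v k p = depth n u v k"
  then show "argmax (excess u v k) p"
    using depth_ge[OF assms(1,2), of k] assms(3) by (simp add: argmax_def)
qed

text \<open>At \<open>p\<close> the two excesses sum to the depth of \<open>(u, v)\<close>, and each
  is bounded by its own depth; the depths therefore add exactly when both bounds are attained at
  \<open>p\<close>.\<close>

lemma depth_additive:
  assumes "u permutes {1..n}" "v permutes {1..n}" "w permutes {1..n}" "k \<in> {1..n}"
    and "argmax (excess u v k) p"
  shows "depth n u w k + depth n w v k = depth n u v k \<longleftrightarrow>
    argmax (excess u w k) p \<and> argmax (excess w v k) p"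
proof -
  have "excess u w k p \<le> depth n u w k" "excess w v k p \<le> depth n w v k"
    using assms by (auto intro!: depth_ge)
  then show ?thesis
    using assms excess_add[of u w k p v] by (auto simp: argmax_depth)
qed

lemma argmax_add:
  assumes "argmax (excess u w k) p" "argmax (excess w v k) p"
  shows "argmax (excess u v k) p"
  unfolding argmax_def
proof
  fix c
  show "excess u v k c \<le> excess u v k p"
    using assms excess_add[of u w k c v] excess_add[of u w k p v]
    unfolding argmax_def by (smt (verit))
qed

section \<open>The tilted relations in terms of maximizers\<close>

text \<open>Counting below thresholds makes the order on subsets accessible to prefix counts. For
  the converse, the threshold \<open>b\<close> forces \<open>a \<le> b\<close>, since some entry of
  \<open>a # as\<close> is at most \<open>b\<close> and \<open>a\<close> is the least; then the
  heads cancel for \<open>x \<ge> b\<close>, and below \<open>b\<close> nothing in \<open>bs\<close>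
  is counted.\<close>

lemma (in linorder) list_all2_iff_filter:
  assumes "sorted_wrt (<) as" "sorted_wrt (<) bs" "length as = length bs"
  shows "list_all2 (\<le>) as bs \<longleftrightarrow>
    (\<forall>x. length (filter (\<lambda>b. b \<le> x) bs) \<le> length (filter (\<lambda>a. a \<le> x) as))"
  using assms(3,1,2)
proof (induction as bs rule: list_induct2)
  case Nil
  then show ?case by simp
next
  case (Cons a as b bs)
  let ?F = "\<lambda>x zs. length (filter (\<lambda>z. z \<le> x) zs)"
  have IH: "list_all2 (\<le>) as bs \<longleftrightarrow> (\<forall>x. ?F x bs \<le> ?F x as)"
    using Cons by simp
  show ?case
  proof
    assume "list_all2 (\<le>) (a # as) (b # bs)"
    then have "a \<le> b" and "\<forall>x. ?F x bs \<le> ?F x as"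
      using IH by auto
    then show "\<forall>x. ?F x (b # bs) \<le> ?F x (a # as)"
      by (auto intro: le_SucI)
  next
    assume R: "\<forall>x. ?F x (b # bs) \<le> ?F x (a # as)"
    have "?F b (a # as) \<noteq> 0"
      using R[rule_format, of b] by auto
    then obtain z where "z \<in> set (a # as)" "z \<le> b"
      by (metis (mono_tags, lifting) filter_False length_0_conv)
    then have ab: "a \<le> b"
      using Cons.prems(1) by auto
    have "?F x bs \<le> ?F x as" for x
    proof (cases "b \<le> x")
      case True
      then have "a \<le> x" using ab by simp
      then show ?thesis using R[rule_format, of x] True by simp
    next
      case False
      then have "filter (\<lambda>z. z \<le> x) bs = []"
        using Cons.prems(2) by (auto simp: filter_empty_conv)
      then show ?thesis by simp
    qed
    then show "list_all2 (\<le>) (a # as) (b # bs)"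
      using IH ab by simp
  qed
qed

lemma (in linorder) sorted_list_all2_iff_card:
  assumes "finite A" "finite B" "card A = card B"
  shows "(\<exists>as bs. set as = A \<and> sorted_wrt (<) as \<and> set bs = B \<and> sorted_wrt (<) bs \<and>
      list_all2 (\<le>) as bs) \<longleftrightarrow>
    (\<forall>x. card {b \<in> B. b \<le> x} \<le> card {a \<in> A. a \<le> x})"
proof -
  have dist: "distinct zs" if "sorted_wrt (<) zs" for zs
    using that by (simp add: strict_sorted_iff)
  have key: "list_all2 (\<le>) as bs \<longleftrightarrow> (\<forall>x. card {b \<in> B. b \<le> x} \<le> card {a \<in> A. a \<le> x})"
    if "set as = A" "sorted_wrt (<) as" "set bs = B" "sorted_wrt (<) bs" for as bs
  proof -
    have F: "length (filter (\<lambda>z. z \<le> x) zs) = card {z \<in> set zs. z \<le> x}"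
      if "sorted_wrt (<) zs" for zs x
      using distinct_card[OF distinct_filter[OF dist[OF that]]] by simp
    have "length as = length bs"
      using that dist assms(3) by (metis distinct_card)
    then show ?thesis
      using list_all2_iff_filter[OF that(2,4)] F that by simp
  qed
  obtain as bs where "set as = A" "sorted_wrt (<) as" "set bs = B" "sorted_wrt (<) bs"
    using assms by (meson strict_sorted_list_of_set set_sorted_list_of_set)
  then show ?thesis
    using key by blast
qed

lemma linorder_cyc: "class.linorder (cyc_le r) (cyc_less r)"
  by unfold_locales (auto simp: cyc_le_def cyc_less_def)

text \<open>The cyclic initial segment ending at \<open>x\<close> is the interval from
  \<open>r\<close> to \<open>x\<close> if \<open>r \<le> x\<close>, and otherwise wraps around:
  everything from \<open>r\<close> on together with everything up to \<open>x\<close>.\<close>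

lemma card_cyc_le:
  assumes "finite B" "1 \<le> r"
  shows "int (card {b \<in> B. cyc_le r b x}) =
    int (card {b \<in> B. b \<le> x}) - int (card {b \<in> B. b \<le> r - 1}) +
    (if r \<le> x then 0 else int (card B))"
proof (cases "r \<le> x")
  case True
  then have "{b \<in> B. b \<le> x} = {b \<in> B. cyc_le r b x} \<union> {b \<in> B. b \<le> r - 1}"
    and "{b \<in> B. cyc_le r b x} \<inter> {b \<in> B. b \<le> r - 1} = {}"
    using assms(2) by (auto simp: cyc_le_def cyc_less_def)
  then show ?thesis
    using True assms(1) by (simp add: card_Un_disjoint)
next
  case False
  define L where "L = {b \<in> B. b \<le> x}"
  define R where "R = {b \<in> B. r \<le> b}"
  have "{b \<in> B. cyc_le r b x} = L \<union> R" "L \<inter> R = {}"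
    using False by (auto simp: L_def R_def cyc_le_def cyc_less_def)
  then have "card {b \<in> B. cyc_le r b x} = card L + card R"
    using assms(1) by (simp add: L_def R_def card_Un_disjoint)
  moreover have "B = {b \<in> B. b \<le> r - 1} \<union> R" "{b \<in> B. b \<le> r - 1} \<inter> R = {}"
    using assms(2) by (auto simp: R_def)
  then have "card B = card {b \<in> B. b \<le> r - 1} + card R"
    using assms(1) by (metis (no_types, lifting) card_Un_disjoint finite_Un)
  ultimately show ?thesis
    using False by (simp add: L_def)
qed

text \<open>Both sets have \<open>k\<close> elements, so the wrap-around term of
  \<open>card_cyc_le\<close> cancels; what remains at each \<open>x\<close> compares the excess at
  \<open>x\<close> with the excess at \<open>r - 1\<close>.\<close>

lemma set_le_iff_argmax:
  assumes "u permutes {1..n}" "v permutes {1..n}" "1 \<le> r"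
  shows "set_le r (u ` {1..k}) (v ` {1..k}) \<longleftrightarrow> argmax (excess u v k) (r - 1)"
proof -
  let ?A = "u ` {1..k}" and ?B = "v ` {1..k}"
  have inj: "inj u" "inj v"
    using assms permutes_inj by auto
  then have card: "card ?A = k" "card ?B = k"
    by (metis card_atLeastAtMost card_image diff_Suc_1 inj_on_subset subset_UNIV)+
  then have "set_le r ?A ?B \<longleftrightarrow>
      (\<forall>x. card {b \<in> ?B. cyc_le r b x} \<le> card {a \<in> ?A. cyc_le r a x})"
    unfolding set_le_def
    by (intro linorder.sorted_list_all2_iff_card[OF linorder_cyc]) auto
  also have "\<dots> \<longleftrightarrow>
      (\<forall>x. int (card {b \<in> ?B. cyc_le r b x}) \<le> int (card {a \<in> ?A. cyc_le r a x}))"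
    by simp
  also have "\<dots> \<longleftrightarrow> argmax (excess u v k) (r - 1)"
    unfolding argmax_def excess_def prefix_count_image[OF inj(1)] prefix_count_image[OF inj(2)]
    using card_cyc_le[OF _ assms(3), of ?A] card_cyc_le[OF _ assms(3), of ?B] card
    by (intro all_cong1) auto
  finally show ?thesis .
qed

lemma tilted_le_iff:
  assumes "u permutes {1..n}" "v permutes {1..n}" "a \<in> {1..n} \<rightarrow>\<^sub>E {1..n}"
  shows "tilted_le n a u v \<longleftrightarrow> (\<forall>k\<in>{1..n}. argmax (excess u v k) (a k - 1))"
  unfolding tilted_le_def
proof (rule ball_cong[OF refl])
  fix k assume "k \<in> {1..n}"
  then have "1 \<le> a k" using assms(3) by (metis PiE_mem atLeastAtMost_iff)
  then show "set_le (a k) (u ` {1..k}) (v ` {1..k}) \<longleftrightarrow> argmax (excess u v k) (a k - 1)"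
    by (rule set_le_iff_argmax[OF assms(1,2)])
qed

lemma card_cyclic_interval:
  assumes "w permutes {1..n}" "k \<le> n" "a \<in> {1..n}" "b \<in> {1..n}"
  shows "int (card (w ` {1..k} \<inter> cyclic_interval n a b)) =
    prefix_count w k (b - 1) - prefix_count w k (a - 1) + (if a \<le> b then 0 else int k)"
proof -
  let ?M = "\<lambda>P. {m \<in> {1..k}. P (w m)}"
  have inj: "inj w" using assms(1) by (rule permutes_inj)
  have bd: "1 \<le> w m" "w m \<le> n" if "m \<in> {1..k}" for m
    using permutes_le[OF assms(1), of m] that assms(2) by auto
  have "w ` {1..k} \<inter> cyclic_interval n a b = w ` ?M (\<lambda>x. x \<in> cyclic_interval n a b)"
    by auto
  then have "int (card (w ` {1..k} \<inter> cyclic_interval n a b)) =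
      (\<Sum>m=1..k. of_bool (w m \<in> cyclic_interval n a b))"
    using inj by (simp add: card_image inj_on_def Int_def)
  \<comment> \<open>Letters lie in \<open>{1..n}\<close>, so membership is a difference of two
    threshold indicators, corrected by 1 if the interval wraps around.\<close>
  also have "\<dots> = (\<Sum>m=1..k. of_bool (w m \<le> b - 1) - of_bool (w m \<le> a - 1) +
      (if a \<le> b then 0 else 1))"
    using bd assms(3,4) by (intro sum.cong) (auto simp: cyclic_interval_def of_bool_def)
  also have "\<dots> = prefix_count w k (b - 1) - prefix_count w k (a - 1) + (if a \<le> b then 0 else int k)"
    by (simp add: prefix_count_def sum.distrib sum_subtractf)
  finally show ?thesis .
qed

lemma tilted_sim_iff:
  assumes "u permutes {1..n}" "v permutes {1..n}" "a \<in> {1..n} \<rightarrow>\<^sub>E {1..n}"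
  shows "tilted_sim n a u v \<longleftrightarrow>
    (\<forall>k\<in>{1..<n}. excess u v k (a (k + 1) - 1) = excess u v k (a k - 1))"
  unfolding tilted_sim_def
proof (rule ball_cong[OF refl])
  fix k assume k: "k \<in> {1..<n}"
  let ?C = "cyclic_interval n (a k) (a (k + 1))"
  have "k \<le> n" "a k \<in> {1..n}" "a (k + 1) \<in> {1..n}"
    using k PiE_mem[OF assms(3), of k] PiE_mem[OF assms(3), of "k + 1"] by auto
  note C = card_cyclic_interval[OF assms(1) this] card_cyclic_interval[OF assms(2) this]
  have "card (u ` {1..k} \<inter> ?C) = card (v ` {1..k} \<inter> ?C) \<longleftrightarrow>
      int (card (u ` {1..k} \<inter> ?C)) = int (card (v ` {1..k} \<inter> ?C))"
    by simp
  also have "\<dots> \<longleftrightarrow> excess u v k (a (k + 1) - 1) = excess u v k (a k - 1)"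
    unfolding C excess_def by linarith
  finally show "card (u ` {1..k} \<inter> ?C) = card (v ` {1..k} \<inter> ?C) \<longleftrightarrow>
      excess u v k (a (k + 1) - 1) = excess u v k (a k - 1)" .
qed

section \<open>Common maximizers for consecutive prefixes\<close>

lemma prefix_count_Suc: "prefix_count w (Suc k) c = prefix_count w k c + of_bool (w (Suc k) \<le> c)"
  by (simp add: prefix_count_def)

text \<open>If \<open>p\<close> does not maximize \<open>g\<close>, then \<open>g q\<close> exceeds
  \<open>g p\<close> by at least 1. Since \<open>g - f\<close> varies by at most 1, this gives
  \<open>f p \<le> f q\<close>, so \<open>q\<close> maximizes \<open>f\<close> too.\<close>

lemma common_argmax:
  assumes "argmax f p" "argmax g q" "\<And>c. g c - f c \<in> {e, e + 1}"
  shows "(argmax f p \<and> argmax g p) \<or> (argmax f q \<and> argmax g q)"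
proof (cases "g p = g q")
  case True
  then show ?thesis using assms by (simp add: argmax_def)
next
  case False
  then have "g p < g q" using assms(2) by (metis argmax_def order_le_less)
  then have "f p \<le> f q" using assms(3)[of p] assms(3)[of q] by auto
  then show ?thesis using assms(1,2) by (meson argmax_def order_trans)
qed

lemma common_argmax_excess:
  assumes u: "u permutes {1..n}" and v: "v permutes {1..n}" and k: "k \<in> {1..n}"
  obtains r where "r \<in> {1..n}" "argmax (excess u v k) (r - 1)"
    "argmax (excess u v (k - 1)) (r - 1)"
proof -
  obtain q where q: "q \<in> {1..n}" "argmax (excess u v k) (q - 1)"
    using depth_attained[OF u v k] argmax_depth[OF u v k] by metis
  show thesis
  proof (cases "k = 1")
    case True
    then have "argmax (excess u v (k - 1)) (q - 1)"
      by (simp add: argmax_def excess_def prefix_count_def)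
    then show thesis using q that by blast
  next
    case False
    then have k1: "k - 1 \<in> {1..n}" using k by auto
    obtain p where p: "p \<in> {1..n}" "argmax (excess u v (k - 1)) (p - 1)"
      using depth_attained[OF u v k1] argmax_depth[OF u v k1] by metis
    \<comment> \<open>Passing from \<open>k - 1\<close> to \<open>k\<close> adds
      \<open>[v k \<le> c] - [u k \<le> c]\<close>, which lies in {0, 1} if
      \<open>v k \<le> u k\<close> and in {-1, 0} otherwise.\<close>
    define e :: int where "e = (if v k \<le> u k then 0 else - 1)"
    have "excess u v k c - excess u v (k - 1) c \<in> {e, e + 1}" for c
      using k prefix_count_Suc[of u "k - 1" c] prefix_count_Suc[of v "k - 1" c]
      by (auto simp: excess_def e_def)
    from common_argmax[OF p(2) q(2) this] show thesis
      using p q that by blast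
  qed
qed

text \<open>Take \<open>a k\<close> from a common maximizer for \<open>k - 1\<close> and
  \<open>k\<close>. Then \<open>a k\<close> and \<open>a (k + 1)\<close> both give maximizers for
  \<open>k\<close>, so the excess agrees there, which is the condition of
  \<open>tilted_sim_iff\<close>.\<close>

lemma tilted_lesssim_exists:
  assumes u: "u permutes {1..n}" and v: "v permutes {1..n}"
  obtains a where "a \<in> {1..n} \<rightarrow>\<^sub>E {1..n}" "tilted_lesssim n a u v"
proof -
  have "\<forall>k\<in>{1..n}. \<exists>r. r \<in> {1..n} \<and> argmax (excess u v k) (r - 1) \<and>
      argmax (excess u v (k - 1)) (r - 1)"
    using common_argmax_excess[OF u v] by metis
  then obtain b where b: "\<forall>k\<in>{1..n}. b k \<in> {1..n} \<and> argmax (excess u v k) (b k - 1) \<and>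
      argmax (excess u v (k - 1)) (b k - 1)"
    by metis
  define a where "a = restrict b {1..n}"
  have a: "a \<in> {1..n} \<rightarrow>\<^sub>E {1..n}"
    using b by (simp add: a_def restrict_PiE_iff)
  have "tilted_le n a u v"
    using b by (simp add: tilted_le_iff[OF u v a]) (simp add: a_def)
  moreover have "excess u v k (a (k + 1) - 1) = excess u v k (a k - 1)" if "k \<in> {1..<n}" for k
  proof -
    have "argmax (excess u v k) (a (k + 1) - 1)" "argmax (excess u v k) (a k - 1)"
      using b[rule_format, of k] b[rule_format, of "k + 1"] that by (auto simp: a_def)
    then show ?thesis by (meson argmax_def order_antisym)
  qed
  then have "tilted_sim n a u v"
    by (simp add: tilted_sim_iff[OF u v a])
  ultimately show thesis
    using a that by (simp add: tilted_lesssim_def)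
qed

section \<open>Length and prefix counts under a transposition\<close>

lemma perm_length_sum:
  "perm_length n w = (\<Sum>a=1..n. \<Sum>b=1..n. of_bool (a < b \<and> w b < w a))"
proof -
  let ?P = "\<lambda>(a, b). a < b \<and> w b < w a"
  have "{(i, j). 1 \<le> i \<and> i < j \<and> j \<le> n \<and> w i > w j} = {p \<in> {1..n} \<times> {1..n}. ?P p}"
    by auto
  then have "perm_length n w = (\<Sum>p\<in>{1..n} \<times> {1..n}. of_bool (?P p))"
    unfolding perm_length_def
    by (simp add: Int_def)
  also have "\<dots> = (\<Sum>a=1..n. \<Sum>b=1..n. of_bool (a < b \<and> w b < w a))"
    by (simp add: sum.cartesian_product split_def del: sum_of_bool_eq)
  finally show ?thesis .
qed

text \<open>Sorts the pairs of positions by whether they avoid \<open>i\<close> and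
  \<open>j\<close>, meet the rest in one entry, or lie inside \<open>{i, j}\<close>, so that
  inversions can be compared class by class.\<close>

lemma sum_square_split_two:
  fixes g :: "'a \<Rightarrow> 'a \<Rightarrow> 'b::comm_monoid_add"
  assumes "finite A" "i \<in> A" "j \<in> A" "i \<noteq> j"
  shows "(\<Sum>a\<in>A. \<Sum>b\<in>A. g a b) =
    (\<Sum>a\<in>A - {i, j}. \<Sum>b\<in>A - {i, j}. g a b) +
    (\<Sum>k\<in>A - {i, j}. g i k + g j k + (g k i + g k j)) +
    (g i i + g i j + (g j i + g j j))"
proof -
  have split: "sum h A = h i + h j + sum h (A - {i, j})" for h :: "'a \<Rightarrow> 'b"
  proof -
    have "sum h A = h i + sum h (A - {i})"
      using assms by (simp add: sum.remove)
    also have "sum h (A - {i}) = h j + sum h (A - {i} - {j})"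
      using assms by (intro sum.remove) auto
    also have "A - {i} - {j} = A - {i, j}" by auto
    finally show ?thesis by (simp add: add.assoc)
  qed
  show ?thesis
    by (simp add: split sum.distrib ac_simps)
qed

text \<open>Pairs avoiding \<open>i\<close> and \<open>j\<close> are unaffected, and the pair
  \<open>(i, j)\<close> becomes an inversion. A third position \<open>k\<close> changes the count
  only when it lies between \<open>i\<close> and \<open>j\<close> with its letter between theirs;
  then both of its pairs become inversions.\<close>

lemma perm_length_transpose:
  assumes w: "inj w" and ij: "1 \<le> i" "i < j" "j \<le> n" and less: "w i < w j"
  shows "perm_length n (w \<circ> transpose i j) =
    perm_length n w + 1 + 2 * card {k. i < k \<and> k < j \<and> w i < w k \<and> w k < w j}"
proof -
  let ?w' = "w \<circ> transpose i j"
  let ?g = "\<lambda>w a b. of_bool (a < b \<and> w b < w a) :: nat"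
  let ?R = "{1..n} - {i, j}"
  let ?h = "\<lambda>w k. ?g w i k + ?g w j k + (?g w k i + ?g w k j)"
  let ?K = "{k. i < k \<and> k < j \<and> w i < w k \<and> w k < w j}"
  have h: "?h ?w' k = ?h w k + 2 * of_bool (k \<in> ?K)" if "k \<in> ?R" for k
  proof -
    have "k \<noteq> i" "k \<noteq> j" using that by auto
    moreover from this have "w k \<noteq> w i" "w k \<noteq> w j"
      using w by (auto dest: injD)
    ultimately show ?thesis
      using ij(2) less by (auto simp: of_bool_def)
  qed
  have "?R \<inter> ?K = ?K"
    using ij by auto
  then have K: "(\<Sum>k\<in>?R. of_bool (k \<in> ?K)) = card ?K"
    by (simp del: mem_Collect_eq)
  have R: "(\<Sum>a\<in>?R. \<Sum>b\<in>?R. ?g ?w' a b) = (\<Sum>a\<in>?R. \<Sum>b\<in>?R. ?g w a b)"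
    by (intro sum.cong) (auto simp: transpose_def)
  have "(\<Sum>k\<in>?R. ?h ?w' k) = (\<Sum>k\<in>?R. ?h w k + 2 * of_bool (k \<in> ?K))"
    using h by (rule sum.cong[OF refl])
  also have "\<dots> = (\<Sum>k\<in>?R. ?h w k) + 2 * card ?K"
    by (simp only: sum.distrib[of _ "\<lambda>k. 2 * of_bool (k \<in> ?K)"] sum_distrib_left[symmetric] K)
  finally have H: "(\<Sum>k\<in>?R. ?h ?w' k) = (\<Sum>k\<in>?R. ?h w k) + 2 * card ?K" .
  have D: "?g ?w' i i + ?g ?w' i j + (?g ?w' j i + ?g ?w' j j) =
      ?g w i i + ?g w i j + (?g w j i + ?g w j j) + 1"
    using ij less by simp
  have "i \<in> {1..n}" "j \<in> {1..n}" "i \<noteq> j"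
    using ij by auto
  note split = sum_square_split_two[OF finite_atLeastAtMost this]
  show ?thesis
    unfolding perm_length_sum split R H D by (simp only: ac_simps)
qed

text \<open>A prefix containing both positions or neither keeps its set of letters; one containing
  only \<open>i\<close> trades \<open>w i\<close> for \<open>w j\<close>.\<close>

lemma prefix_count_transpose:
  assumes "1 \<le> i" "i < j"
  shows "prefix_count (w \<circ> transpose i j) k c =
    prefix_count w k c + (if i \<le> k \<and> k < j then of_bool (w j \<le> c) - of_bool (w i \<le> c) else 0)"
proof -
  consider "k < i" | "i \<le> k" "k < j" | "j \<le> k" by linarith
  then show ?thesis
  proof cases
    case 1
    then have "prefix_count (w \<circ> transpose i j) k c = prefix_count w k c"
      unfolding prefix_count_def using assms by (intro sum.cong) (auto simp: transpose_def)
    then show ?thesis using 1 by simp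
  next
    case 2
    have split: "prefix_count x k c = of_bool (x i \<le> c) + (\<Sum>m\<in>{1..k} - {i}. of_bool (x m \<le> c))" for x
      unfolding prefix_count_def using assms 2 by (intro sum.remove) auto
    have "(\<Sum>m\<in>{1..k} - {i}. of_bool ((w \<circ> transpose i j) m \<le> c)) =
        (\<Sum>m\<in>{1..k} - {i}. of_bool (w m \<le> c) :: int)"
      using 2 by (intro sum.cong) (auto simp: transpose_def)
    then show ?thesis using 2 split[of w] split[of "w \<circ> transpose i j"] by simp
  next
    case 3
    have "transpose i j permutes {1..k}"
      using assms 3 by (intro permutes_swap_id) auto
    then have "prefix_count (w \<circ> transpose i j) k c = prefix_count w k c"
      unfolding prefix_count_def
      by (subst sum.permute[of "transpose i j" _ "\<lambda>m. of_bool (w m \<le> c)"]) (simp_all only: o_def)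
    then show ?thesis using 3 by simp
  qed
qed

lemma transpose_permutes:
  fixes n :: nat
  assumes "w permutes {1..n}" "1 \<le> i" "i < j" "j \<le> n"
  shows "w \<circ> transpose i j permutes {1..n}"
  by (rule permutes_compose[OF permutes_swap_id]) (use assms in auto)

lemma sum_of_bool_window:
  assumes "1 \<le> i" "i < j" "j \<le> n"
  shows "(\<Sum>k=1..n. of_bool (i \<le> k \<and> k < j)) = int j - int i"
proof -
  have "{1..n} \<inter> {k. i \<le> k \<and> k < j} = {i..<j}" using assms by auto
  then show ?thesis using assms by (simp del: Int_Collect)
qed

lemma qbg_permutes:
  assumes "(x, y) \<in> qbg n"
  shows "x permutes {1..n}" "y permutes {1..n}"
  using assms transpose_permutes unfolding qbg_def by blast+

section \<open>The distance in the quantum Bruhat graph is the potential\<close>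

text \<open>By the triangle inequality the depth sum falls by at most that of \<open>(x, y)\<close>.
  If \<open>x i < x j\<close>, that sum is at most 0 and the length rises, necessarily by 1.
  Otherwise it is at most \<open>j - i\<close>, and the length falls, necessarily by
  \<open>2 * (j - i) - 1\<close>. Either way the potential falls by at most 1.\<close>

lemma potential_edge:
  assumes e: "(x, y) \<in> qbg n" and v: "v permutes {1..n}"
  shows "potential n x v \<le> 1 + potential n y v"
proof -
  obtain i j where y: "y = x \<circ> transpose i j" and x: "x permutes {1..n}"
    and ij: "1 \<le> i" "i < j" "j \<le> n"
    and len: "int (perm_length n y) = int (perm_length n x) + 1 \<or>
      int (perm_length n y) = int (perm_length n x) + 1 - 2 * (int j - int i)"
    using e unfolding qbg_def by auto
  have yp: "y permutes {1..n}" using qbg_permutes[OF e] by simp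
  have injx: "inj x" and injy: "inj y" using x yp permutes_inj by auto
  have ex: "excess x y k c =
      (if i \<le> k \<and> k < j then of_bool (x j \<le> c) - of_bool (x i \<le> c) else 0)" for k c
    using prefix_count_transpose[OF ij(1,2), of x k c] by (simp add: excess_def y)
  have "depth n x v k - depth n y v k \<le> depth n x y k" if "k \<in> {1..n}" for k
    using depth_triangle[OF x v yp, of k] that by simp
  then have tri: "(\<Sum>k=1..n. depth n x v k) - (\<Sum>k=1..n. depth n y v k) \<le> (\<Sum>k=1..n. depth n x y k)"
    by (simp only: sum_subtractf[symmetric] sum_mono)
  have ne: "x i \<noteq> x j" using injx ij by (auto dest: injD)
  show ?thesis
  proof (cases "x i < x j")
    case True
    have "depth n x y k \<le> 0" for k
      using True by (intro depth_leI) (auto simp: ex)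
    then have "(\<Sum>k=1..n. depth n x y k) \<le> 0"
      by (intro sum_nonpos)
    moreover have "perm_length n x < perm_length n y"
      using perm_length_transpose[OF injx ij True] by (simp add: y)
    ultimately show ?thesis
      using tri len ij(2) by (auto simp: potential_def)
  next
    case False
    have "depth n x y k \<le> of_bool (i \<le> k \<and> k < j)" for k
      by (intro depth_leI) (auto simp: ex)
    then have "(\<Sum>k=1..n. depth n x y k) \<le> int j - int i"
      unfolding sum_of_bool_window[OF ij, symmetric] by (intro sum_mono)
    moreover have "y i < y j" "x = y \<circ> transpose i j"
      using False ne by (auto simp: y fun_eq_iff)
    then have "perm_length n y < perm_length n x"
      using perm_length_transpose[OF injy ij] by simp
    ultimately show ?thesis
      using tri len by (auto simp: potential_def)
  qed
qed

lemma potential_refl: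
  assumes "v permutes {1..n}"
  shows "potential n v v = 0"
proof -
  have "depth n v v k = 0" if "k \<in> {1..n}" for k
    using depth_attained[OF assms assms that] by (force simp: excess_def)
  then show ?thesis by (simp add: potential_def)
qed

lemma potential_le_walk:
  assumes "v permutes {1..n}"
  shows "(x, v) \<in> qbg n ^^ k \<Longrightarrow> potential n x v \<le> int k"
proof (induction k arbitrary: x)
  case 0
  then show ?case using potential_refl[OF assms] by simp
next
  case (Suc k)
  then obtain y where "(x, y) \<in> qbg n" "(y, v) \<in> qbg n ^^ k"
    by (metis relpow_Suc_D2)
  then show ?case using Suc.IH potential_edge[OF _ assms] by fastforce
qed

text \<open>
  Greedy step: let \<open>i\<close> be the first position where \<open>u\<close> and \<open>v\<close> differ, and \<open>j > i\<close> the first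
  position whose letter lies in the cyclic interval from \<open>u i\<close> (excluded) to \<open>v i\<close> (included).
  By minimality of \<open>j\<close>, exchanging the letters at \<open>i\<close> and \<open>j\<close> is an edge; and for \<open>i \<le> k < j\<close> the
  excess at \<open>v i\<close> beats the excess at every \<open>c\<close> in the cyclic interval from \<open>u i\<close> to \<open>v i - 1\<close>,
  so the exchange does not push the maximum up there.
\<close>

lemma potential_descent:
  assumes u: "u permutes {1..n}" and v: "v permutes {1..n}" and "u \<noteq> v"
  obtains u' where "(u, u') \<in> qbg n" "potential n u' v \<le> potential n u v - 1"
proof -
  define i where "i = (LEAST i. u i \<noteq> v i)"
  have "\<exists>i. u i \<noteq> v i" using \<open>u \<noteq> v\<close> by (simp add: fun_eq_iff)
  then have i: "u i \<noteq> v i" unfolding i_def by (rule LeastI_ex)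
  have before: "u m = v m" if "m < i" for m
    using that not_less_Least unfolding i_def by blast
  have iA: "i \<in> {1..n}"
    using i u v by (metis permutes_not_in)
  define P where "P x \<longleftrightarrow> (if u i < v i then u i < x \<and> x \<le> v i else u i < x \<or> x \<le> v i)" for x
  define j where "j = (LEAST j. i < j \<and> P (u j))"
  have injs: "inj u" "inj v" using u v permutes_inj by auto
  \<comment> \<open>The position of the letter \<open>v i\<close> in \<open>u\<close> shows that
    \<open>j\<close> exists and is at most \<open>n\<close>.\<close>
  obtain j0 where j0: "j0 \<in> {1..n}" "u j0 = v i"
    using iA permutes_image[OF u] permutes_in_image[OF v, of i] by (metis imageE)
  have "j0 \<noteq> i" using j0(2) i by metis
  moreover have "\<not> j0 < i"
    using before[of j0] j0(2) injs(2) by (metis injD less_irrefl)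
  ultimately have j0_ok: "i < j0 \<and> P (u j0)"
    using j0(2) i by (auto simp: P_def)
  then have j: "i < j" "P (u j)" and "j \<le> j0"
    unfolding j_def using LeastI[of "\<lambda>j. i < j \<and> P (u j)"] by (blast, blast, intro Least_le)
  have between: "\<not> P (u m)" if "i < m" "m < j" for m
    using that not_less_Least[of m "\<lambda>j. i < j \<and> P (u j)"] unfolding j_def by blast
  have ij: "1 \<le> i" "i < j" "j \<le> n" using iA j \<open>j \<le> j0\<close> j0(1) by auto
  define Q where "Q c \<longleftrightarrow> (if u i < v i then u i \<le> c \<and> c < v i else u i \<le> c \<or> c < v i)" for c
  have gain: "excess u v k c + 1 \<le> depth n u v k" if k: "i \<le> k" "k < j" and c: "Q c" for k c
  proof -
    \<comment> \<open>The contribution of position \<open>m\<close> to the excess at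
      \<open>v i\<close> minus the excess at \<open>c\<close>: zero before \<open>i\<close>, at
      least 1 at \<open>i\<close>, and nonnegative between \<open>i\<close> and \<open>j\<close>
      because \<open>u m\<close> avoids the cyclic interval \<open>P\<close>.\<close>
    define T :: "nat \<Rightarrow> int" where "T m = (of_bool (v m \<le> v i) - of_bool (u m \<le> v i)) -
      (of_bool (v m \<le> c) - of_bool (u m \<le> c))" for m
    have "of_bool (m = i) \<le> T m" if m: "m \<in> {1..k}" for m
    proof -
      consider "m < i" | "m = i" | "i < m" "m < j" using m k by fastforce
      then show ?thesis
      proof cases
        case 1
        then show ?thesis using before by (simp add: T_def)
      next
        case 2
        then show ?thesis using c i by (auto simp: T_def Q_def of_bool_def split: if_splits)
      next
        case 3
        then show ?thesis using between[of m] c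
          by (auto simp: T_def Q_def P_def of_bool_def split: if_splits)
      qed
    qed
    then have "(\<Sum>m=1..k. of_bool (m = i)) \<le> (\<Sum>m=1..k. T m)"
      by (intro sum_mono)
    moreover have "(\<Sum>m=1..k. of_bool (m = i) :: int) = 1"
      using k ij by (simp add: of_bool_def)
    moreover have "(\<Sum>m=1..k. T m) = excess u v k (v i) - excess u v k c"
      by (simp only: T_def sum_subtractf excess_def prefix_count_def)
    moreover have "excess u v k (v i) \<le> depth n u v k"
      using k ij by (intro depth_ge[OF u v]) auto
    ultimately show ?thesis by linarith
  qed
  define u' where "u' = u \<circ> transpose i j"
  have u': "u' permutes {1..n}"
    unfolding u'_def using u ij by (rule transpose_permutes)
  have ex: "excess u' v k c = excess u v k c -
      (if i \<le> k \<and> k < j then of_bool (u j \<le> c) - of_bool (u i \<le> c) else 0)" for k c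
    using prefix_count_transpose[OF ij(1,2), of u k c] by (simp add: excess_def u'_def)
  have ne: "u i \<noteq> u j" using injs(1) ij by (auto dest: injD)
  show thesis
  proof (cases "u i < u j")
    case True
    have "{k. i < k \<and> k < j \<and> u i < u k \<and> u k < u j} = {}"
      using between j(2) by (fastforce simp: P_def split: if_splits)
    then have len: "int (perm_length n u') = int (perm_length n u) + 1"
      unfolding u'_def by (simp only: perm_length_transpose[OF injs(1) ij True]) simp
    have "depth n u' v k \<le> depth n u v k" if "k \<in> {1..n}" for k
    proof (rule depth_leI)
      fix c
      show "excess u' v k c \<le> depth n u v k"
      proof (cases "i \<le> k \<and> k < j \<and> u i \<le> c \<and> c < u j")
        case kc: True
        then have "Q c" using True j(2) by (auto simp: P_def Q_def split: if_splits)
        then show ?thesis using gain[of k c] kc by (simp add: ex)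
      next
        case False
        then have "excess u' v k c \<le> excess u v k c" by (auto simp: ex)
        also have "\<dots> \<le> depth n u v k" using that by (intro depth_ge[OF u v]) auto
        finally show ?thesis .
      qed
    qed
    then have "(\<Sum>k=1..n. depth n u' v k) \<le> (\<Sum>k=1..n. depth n u v k)"
      by (rule sum_mono)
    then have "potential n u' v \<le> potential n u v - 1"
      using len by (simp add: potential_def)
    moreover have "(u, u') \<in> qbg n"
      unfolding qbg_def using u ij len u'_def by auto
    ultimately show thesis using that by blast
  next
    case False
    then have less: "u j < u i" using ne by simp
    then have uv: "u j \<le> v i" "v i < u i"
      using j(2) i by (auto simp: P_def split: if_splits)
    have "u' i < u' j" "u = u' \<circ> transpose i j"
      using less by (auto simp: u'_def fun_eq_iff)
    \<comment> \<open>In the wrapping case, letters avoiding \<open>P\<close> lie between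
      \<open>v i\<close> and \<open>u i\<close>, hence between \<open>u j\<close> and
      \<open>u i\<close>. So every intermediate position counts, and the length falls by exactly
      \<open>2 * (j - i) - 1\<close>.\<close>
    moreover have "{k. i < k \<and> k < j \<and> u' i < u' k \<and> u' k < u' j} = {i<..<j}"
    proof -
      have "u j < u k \<and> u k < u i" if "i < k" "k < j" for k
      proof -
        have "u k \<noteq> u i" using injs(1) that by (auto dest: injD)
        then show ?thesis using between[OF that] uv by (auto simp: P_def)
      qed
      then show ?thesis by (auto simp: u'_def transpose_def)
    qed
    ultimately have "perm_length n u = perm_length n u' + 1 + 2 * card {i<..<j}"
      using perm_length_transpose[OF permutes_inj[OF u'] ij] by simp
    then have len: "int (perm_length n u') = int (perm_length n u) + 1 - 2 * (int j - int i)"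
      using ij by simp
    have "depth n u' v k \<le> depth n u v k - of_bool (i \<le> k \<and> k < j)" if "k \<in> {1..n}" for k
    proof (rule depth_leI)
      fix c
      show "excess u' v k c \<le> depth n u v k - of_bool (i \<le> k \<and> k < j)"
      \<comment> \<open>For \<open>i \<le> k < j\<close> the depth must drop by 1 to outweigh the
        loss of length. Where \<open>u j \<le> c < u i\<close> the excess itself drops; at the other
        thresholds \<open>Q c\<close> holds and \<open>gain\<close> supplies the slack.\<close>
      proof (cases "i \<le> k \<and> k < j \<and> \<not> (u j \<le> c \<and> c < u i)")
        case kc: True
        then have "Q c" using uv by (auto simp: Q_def)
        then show ?thesis using gain[of k c] kc less by (auto simp: ex)
      next
        case False
        then have "excess u' v k c = excess u v k c - of_bool (i \<le> k \<and> k < j)"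
          by (auto simp: ex)
        moreover have "excess u v k c \<le> depth n u v k"
          using that by (intro depth_ge[OF u v]) auto
        ultimately show ?thesis by simp
      qed
    qed
    then have "(\<Sum>k=1..n. depth n u' v k) \<le>
        (\<Sum>k=1..n. depth n u v k - of_bool (i \<le> k \<and> k < j))"
      by (rule sum_mono)
    also have "\<dots> = (\<Sum>k=1..n. depth n u v k) - (int j - int i)"
      unfolding sum_subtractf sum_of_bool_window[OF ij] ..
    finally have "potential n u' v \<le> potential n u v - 1"
      using len by (simp add: potential_def)
    moreover have "(u, u') \<in> qbg n"
      unfolding qbg_def using u ij len u'_def by auto
    ultimately show thesis using that by blast
  qed
qed

text \<open>The descent terminates because there are finitely many permutations: a counterexample of
  least potential has a neighbour of smaller potential, whose walk to \<open>v\<close> extends by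
  one edge.\<close>

lemma walk_exists:
  assumes u: "u permutes {1..n}" and v: "v permutes {1..n}"
  shows "\<exists>k. (u, v) \<in> qbg n ^^ k \<and> int k \<le> potential n u v"
proof (rule ccontr)
  define B where "B = {x. x permutes {1..n} \<and>
    \<not> (\<exists>k. (x, v) \<in> qbg n ^^ k \<and> int k \<le> potential n x v)}"
  assume "\<nexists>k. (u, v) \<in> qbg n ^^ k \<and> int k \<le> potential n u v"
  then have "B \<noteq> {}" using u by (auto simp: B_def)
  moreover have "finite B"
    using finite_permutations[of "{1..n}"] by (auto simp: B_def)
  ultimately obtain x where x: "x \<in> B" "\<forall>y\<in>B. potential n x v \<le> potential n y v"
    using ex_min_if_finite[of "(\<lambda>x. potential n x v) ` B"] by (auto simp: not_less)
  have xp: "x permutes {1..n}" using x(1) by (simp add: B_def)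
  have "x \<noteq> v"
  proof
    assume "x = v"
    then have "(x, v) \<in> qbg n ^^ 0 \<and> int 0 \<le> potential n x v"
      using potential_refl[OF v] by simp
    then show False using x(1) unfolding B_def by blast
  qed
  then obtain y where y: "(x, y) \<in> qbg n" "potential n y v \<le> potential n x v - 1"
    using potential_descent[OF xp v] by blast
  then have "y \<notin> B" using x(2) by force
  then obtain k where k: "(y, v) \<in> qbg n ^^ k" "int k \<le> potential n y v"
    using qbg_permutes[OF y(1)] by (auto simp: B_def)
  have "(x, v) \<in> qbg n ^^ Suc k" using y(1) k(1) by (rule relpow_Suc_I2)
  moreover have "int (Suc k) \<le> potential n x v" using k(2) y(2) by simp
  ultimately show False using x(1) unfolding B_def by blast
qed

lemma qbg_dist_eq_potential:
  assumes "u permutes {1..n}" "v permutes {1..n}"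
  shows "int (qbg_dist n u v) = potential n u v"
proof -
  obtain k where k: "(u, v) \<in> qbg n ^^ k" "int k \<le> potential n u v"
    using walk_exists[OF assms] by blast
  have "qbg_dist n u v \<le> k"
    unfolding qbg_dist_def using k(1) by (rule Least_le)
  moreover have "(u, v) \<in> qbg n ^^ qbg_dist n u v"
    unfolding qbg_dist_def using k(1) by (rule LeastI)
  then have "potential n u v \<le> int (qbg_dist n u v)"
    by (rule potential_le_walk[OF assms(2)])
  ultimately show ?thesis using k(2) by linarith
qed

section \<open>Tilted intervals and the equivalences\<close>

text \<open>Lengths telescope, so the defect in the distances is twice the sum of the depth defects;
  these are nonnegative by \<open>depth_triangle\<close>, so the sum vanishes only if each of them
  does.\<close>

lemma tilted_interval_iff_depth:
  assumes u: "u permutes {1..n}" and v: "v permutes {1..n}" and w: "w permutes {1..n}"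
  shows "w \<in> tilted_interval n u v \<longleftrightarrow>
    (\<forall>k\<in>{1..n}. depth n u w k + depth n w v k = depth n u v k)"
proof -
  let ?f = "\<lambda>k. depth n u w k + depth n w v k - depth n u v k"
  have "w \<in> tilted_interval n u v \<longleftrightarrow>
      int (qbg_dist n u w) + int (qbg_dist n w v) = int (qbg_dist n u v)"
    using w by (auto simp: tilted_interval_def)
  also have "\<dots> \<longleftrightarrow> (\<Sum>k=1..n. ?f k) = 0"
    using assms by (simp add: qbg_dist_eq_potential potential_def sum.distrib sum_subtractf) linarith
  also have "\<dots> \<longleftrightarrow> (\<forall>k\<in>{1..n}. ?f k = 0)"
    using depth_triangle[OF u v w] by (intro sum_nonneg_eq_0_iff) auto
  finally show ?thesis by auto
qed

lemma tilted_le_split_iff: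
  assumes u: "u permutes {1..n}" and v: "v permutes {1..n}" and w: "w permutes {1..n}"
    and a: "a \<in> {1..n} \<rightarrow>\<^sub>E {1..n}" and le: "tilted_le n a u v"
  shows "tilted_le n a u w \<and> tilted_le n a w v \<longleftrightarrow> w \<in> tilted_interval n u v"
  using le depth_additive[OF u v w]
  by (auto simp: tilted_interval_iff_depth[OF u v w] tilted_le_iff[OF u v a]
      tilted_le_iff[OF u w a] tilted_le_iff[OF w v a])

lemma tilted_le_trans:
  assumes "u permutes {1..n}" "v permutes {1..n}" "w permutes {1..n}"
    and "a \<in> {1..n} \<rightarrow>\<^sub>E {1..n}" and "tilted_le n a u w" "tilted_le n a w v"
  shows "tilted_le n a u v"
  using assms argmax_add by (auto simp: tilted_le_iff)

text \<open>
  Both excesses are at most their values at \<open>a k - 1\<close>, so if their sum has equal values at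
  \<open>a k - 1\<close> and \<open>a (k + 1) - 1\<close>, then so has each of them.
\<close>

lemma tilted_sim_split:
  assumes u: "u permutes {1..n}" and v: "v permutes {1..n}" and w: "w permutes {1..n}"
    and a: "a \<in> {1..n} \<rightarrow>\<^sub>E {1..n}"
    and le: "tilted_le n a u w" "tilted_le n a w v" and sim: "tilted_sim n a u v"
  shows "tilted_sim n a u w \<and> tilted_sim n a w v"
proof -
  have "excess u w k (a (k + 1) - 1) = excess u w k (a k - 1) \<and>
      excess w v k (a (k + 1) - 1) = excess w v k (a k - 1)" if k: "k \<in> {1..<n}" for k
  proof -
    let ?p = "a k - 1" and ?q = "a (k + 1) - 1"
    have "excess u w k ?q \<le> excess u w k ?p" "excess w v k ?q \<le> excess w v k ?p"
      using le k by (auto simp: tilted_le_iff[OF u w a] tilted_le_iff[OF w v a] argmax_def)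
    moreover have "excess u v k ?q = excess u v k ?p"
      using sim k by (simp add: tilted_sim_iff[OF u v a])
    ultimately show ?thesis
      using excess_add[of u w k ?p v] excess_add[of u w k ?q v] by linarith
  qed
  then show ?thesis
    by (simp add: tilted_sim_iff[OF u w a] tilted_sim_iff[OF w v a])
qed

theorem theorem3p13:
  fixes n :: nat and u v w :: "nat \<Rightarrow> nat"
  assumes "u permutes {1..n}" and "v permutes {1..n}" and "w permutes {1..n}"
  shows "(w \<in> tilted_interval n u v \<longleftrightarrow>
            (\<forall>a \<in> {1..n} \<rightarrow>\<^sub>E {1..n}. tilted_le n a u v \<longrightarrow>
               tilted_le n a u w \<and> tilted_le n a w v)) \<and>
         (w \<in> tilted_interval n u v \<longleftrightarrow>
            (\<exists>a \<in> {1..n} \<rightarrow>\<^sub>E {1..n}. tilted_le n a u w \<and> tilted_le n a w v)) \<and>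
         (w \<in> tilted_interval n u v \<longleftrightarrow>
            (\<forall>a \<in> {1..n} \<rightarrow>\<^sub>E {1..n}. tilted_lesssim n a u v \<longrightarrow>
               tilted_lesssim n a u w \<and> tilted_lesssim n a w v)) \<and>
         (w \<in> tilted_interval n u v \<longleftrightarrow>
            (\<exists>a \<in> {1..n} \<rightarrow>\<^sub>E {1..n}. tilted_lesssim n a u w \<and> tilted_lesssim n a w v))"
proof -
  note le_split = tilted_le_split_iff[OF assms]
  note sim_split = tilted_sim_split[OF assms]
  \<comment> \<open>This \<open>b\<close> makes the two universal conditions non-vacuous and is the
    witness for the two existential ones.\<close>
  obtain b where b: "b \<in> {1..n} \<rightarrow>\<^sub>E {1..n}" "tilted_lesssim n b u v"
    using tilted_lesssim_exists[OF assms(1,2)] by blast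
  have le_iff: "tilted_le n a u w \<and> tilted_le n a w v \<longleftrightarrow>
      tilted_le n a u v \<and> w \<in> tilted_interval n u v" if "a \<in> {1..n} \<rightarrow>\<^sub>E {1..n}" for a
    using le_split[OF that] tilted_le_trans[OF assms that] by blast
  have lesssim: "tilted_lesssim n a u w \<and> tilted_lesssim n a w v \<longleftrightarrow> w \<in> tilted_interval n u v"
    if "a \<in> {1..n} \<rightarrow>\<^sub>E {1..n}" "tilted_lesssim n a u v" for a
    using that le_split[OF that(1)] sim_split[OF that(1)] unfolding tilted_lesssim_def by blast
  show ?thesis
    using b le_iff lesssim unfolding tilted_lesssim_def by blast
qed

end
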